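(* Let $K$ be a Krein space with fundamental symmetry $J$, and let $P$ be an orthogonal projection on $K$ commuting with $J$. (1) If $\{f_n\}_{n\in\mathbb{N}}$ is a frame for $K$ with frame bounds $B_2\le A_2<0<A_1\le B_1$, then $\{Pf_n\}_{n\in\mathbb{N}}$ is a frame for $PK$ and $\{(I-P)f_n\}_{n\in\mathbb{N}}$ is a frame for $(I-P)K$, both admitting the same frame bounds. (2) Conversely, if $\{f_n\}_{n\in\mathbb{N}}$ is a frame for $PK$ and $\{g_n\}_{n\in\mathbb{N}}$ is a frame for $(I-P)K$, both with frame bounds $B_2\le A_2<0<A_1\le B_1$, then $\{f_n\}_{n\in\mathbb{N}}\cup\{g_n\}_{n\in\mathbb{N}}$ (as an indexed family) is a frame for $K$ admitting the same frame bounds.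
   Context: Let $K$ be a Krein space with indefinite inner product $\langle\cdot,\cdot\rangle$ and a fundamental decomposition $K=K^+\dot{+}K^-$ ($K^+\perp K^-$, $(K^+,\langle\cdot,\cdot\rangle)$ a Hilbert space, $(K^-,-\langle\cdot,\cdot\rangle)$ a Hilbert space) with associated fundamental symmetry $J$ ($J=I$ on $K^+$, $J=-I$ on $K^-$). In the paper this decomposition is the one induced by a countable $J$-orthonormal basis: $K^\pm$ is the closed span of the basis vectors $e_i$ with $\langle e_i,e_i\rangle=\pm1$. Write $x=x^++x^-$ with $x^\pm\in K^\pm$. A sequence $\{f_n\}$ in $K$ is a frame for $K$ with frame bounds $B_2\le A_2<0<A_1\le B_1$ (real numbers) if $A_1\langle x^+,x^+\rangle\le\sum_n|\langle x^+,f_n^+\rangle|^2\le B_1\langle x^+,x^+\rangle$ for all $x^+\in K^+$ and $A_2\langle x^-,x^-\rangle\le\sum_n|\langle x^-,f_n^-\rangle|^2\le B_2\langle x^-,x^-\rangle$ for all $x^-\in K^-$. An orthogonal projection $P$ on $K$ is a bounded operator with $P^2=P$ and $\langle Px,y\rangle=\langle x,Py\rangle$ for all $x,y\in K$. When $PJ=JP$, the subspaces $PK$ and $(I-P)K$ are Krein spaces under the restricted inner product, with fundamental symmetries $PJ$ and $(I-P)J$ (restricted to them), i.e. fundamental decompositions $PK=PK^+\dot{+}PK^-$ and $(I-P)K=(I-P)K^+\dot{+}(I-P)K^-$; frames for these subspaces are understood with respect to these decompositions. *)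

theory Defs
  imports "HOL-Analysis.Analysis"
begin

text \<open>
  The distribution has no class of complex inner product spaces, so the vector space structure is
  given by a scalar multiplication by complex numbers on an abelian group, and the possibly
  indefinite form by a two-argument function, linear in its first argument.
\<close>

locale hermitian_form = vector_space smul
  for smul :: "complex \<Rightarrow> 'a::ab_group_add \<Rightarrow> 'a" +
  fixes ip :: "'a \<Rightarrow> 'a \<Rightarrow> complex"
  assumes ip_add_left: "ip (x + y) z = ip x z + ip y z"
    and ip_scale_left: "ip (smul c x) y = c * ip x y"
    and ip_cnj: "ip y x = cnj (ip x y)"

text \<open>For a Hermitian form the number \<open>ip x x\<close> is real, so \<open>Re\<close> only changes the type.\<close>

definition ip_norm :: "('a \<Rightarrow> 'a \<Rightarrow> complex) \<Rightarrow> 'a \<Rightarrow> real" where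
  "ip_norm ip x = sqrt (Re (ip x x))"

definition hilbert_subspace ::
  "(complex \<Rightarrow> 'a::ab_group_add \<Rightarrow> 'a) \<Rightarrow> ('a \<Rightarrow> 'a \<Rightarrow> complex) \<Rightarrow> 'a set \<Rightarrow> bool" where
  "hilbert_subspace smul ip S \<longleftrightarrow>
     module.subspace smul S \<and>
     (\<forall>x\<in>S. x \<noteq> 0 \<longrightarrow> 0 < Re (ip x x)) \<and>
     (\<forall>X::nat \<Rightarrow> 'a. (\<forall>n. X n \<in> S) \<and>
        (\<forall>e>0. \<exists>N. \<forall>m\<ge>N. \<forall>n\<ge>N. ip_norm ip (X m - X n) < e) \<longrightarrow>
        (\<exists>l\<in>S. (\<lambda>n. ip_norm ip (X n - l)) \<longlonglongrightarrow> 0))"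

text \<open>
  The subspace \<open>K\<close>, with the restriction of \<open>ip\<close>, is a Krein space with fundamental
  decomposition \<open>K = Kp + Km\<close>. The carrier \<open>K\<close> is explicit so that the same notion applies to a
  whole space (\<open>K = UNIV\<close>) and to the range of a projection.
\<close>

locale krein_space = hermitian_form smul ip
  for smul :: "complex \<Rightarrow> 'a::ab_group_add \<Rightarrow> 'a" and ip :: "'a \<Rightarrow> 'a \<Rightarrow> complex" +
  fixes K Kp Km :: "'a set"
  assumes decomp_sum: "K = {p + m | p m. p \<in> Kp \<and> m \<in> Km}"
    and decomp_direct: "Kp \<inter> Km = {0}"
    and decomp_orthogonal: "\<lbrakk>p \<in> Kp; m \<in> Km\<rbrakk> \<Longrightarrow> ip p m = 0"
    and hilbert_pos: "hilbert_subspace smul ip Kp"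
    and hilbert_neg: "hilbert_subspace smul (\<lambda>x y. - ip x y) Km"

text \<open>
  The components \<open>x\<^sup>+\<close> and \<open>x\<^sup>-\<close> of a vector. They are well defined for \<open>x\<close> in the direct sum of
  \<open>Kp\<close> and \<open>Km\<close>.
\<close>

definition pos_component :: "'a::ab_group_add set \<Rightarrow> 'a set \<Rightarrow> 'a \<Rightarrow> 'a" where
  "pos_component Kp Km x = (THE p. p \<in> Kp \<and> x - p \<in> Km)"

definition neg_component :: "'a::ab_group_add set \<Rightarrow> 'a set \<Rightarrow> 'a \<Rightarrow> 'a" where
  "neg_component Kp Km x = (THE m. m \<in> Km \<and> x - m \<in> Kp)"

definition fundamental_symmetry :: "'a::ab_group_add set \<Rightarrow> 'a set \<Rightarrow> 'a \<Rightarrow> 'a" where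
  "fundamental_symmetry Kp Km x = pos_component Kp Km x - neg_component Kp Km x"

text \<open>Norm of the Hilbert space inner product \<open>[x, y] = ip (J x) y\<close>.\<close>

definition J_norm :: "('a \<Rightarrow> 'a \<Rightarrow> complex) \<Rightarrow> 'a::ab_group_add set \<Rightarrow> 'a set \<Rightarrow> 'a \<Rightarrow> real" where
  "J_norm ip Kp Km = ip_norm (\<lambda>x y. ip (fundamental_symmetry Kp Km x) y)"

definition orthogonal_projection ::
  "(complex \<Rightarrow> 'a::ab_group_add \<Rightarrow> 'a) \<Rightarrow> ('a \<Rightarrow> 'a \<Rightarrow> complex) \<Rightarrow> 'a set \<Rightarrow> 'a set
    \<Rightarrow> ('a \<Rightarrow> 'a) \<Rightarrow> bool" where
  "orthogonal_projection smul ip Kp Km P \<longleftrightarrow>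
     Vector_Spaces.linear smul smul P \<and>
     (\<exists>C. \<forall>x. J_norm ip Kp Km (P x) \<le> C * J_norm ip Kp Km x) \<and>
     (\<forall>x. P (P x) = P x) \<and>
     (\<forall>x y. ip (P x) y = ip x (P y))"

text \<open>
  Frame with bounds \<open>B\<^sub>2 \<le> A\<^sub>2 < 0 < A\<^sub>1 \<le> B\<^sub>1\<close> for the Krein space \<open>K\<close> with fundamental
  decomposition \<open>K = Kp + Km\<close>. The index type is arbitrary; the terms are nonnegative, so for
  sequences unconditional summation is ordinary summation. Convergence must be required because
  \<open>infsum\<close> is zero for divergent sums.
\<close>

definition krein_frame ::
  "('a \<Rightarrow> 'a \<Rightarrow> complex) \<Rightarrow> 'a::ab_group_add set \<Rightarrow> 'a set \<Rightarrow> 'a set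
    \<Rightarrow> ('i \<Rightarrow> 'a) \<Rightarrow> real \<Rightarrow> real \<Rightarrow> real \<Rightarrow> real \<Rightarrow> bool" where
  "krein_frame ip K Kp Km f A1 B1 A2 B2 \<longleftrightarrow>
     B2 \<le> A2 \<and> A2 < 0 \<and> 0 < A1 \<and> A1 \<le> B1 \<and>
     (\<forall>i. f i \<in> K) \<and>
     (\<forall>x\<in>Kp.
        (\<lambda>i. (cmod (ip x (pos_component Kp Km (f i))))\<^sup>2) summable_on UNIV \<and>
        A1 * Re (ip x x) \<le> (\<Sum>\<^sub>\<infinity>i. (cmod (ip x (pos_component Kp Km (f i))))\<^sup>2) \<and>
        (\<Sum>\<^sub>\<infinity>i. (cmod (ip x (pos_component Kp Km (f i))))\<^sup>2) \<le> B1 * Re (ip x x)) \<and>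
     (\<forall>x\<in>Km.
        (\<lambda>i. (cmod (ip x (neg_component Kp Km (f i))))\<^sup>2) summable_on UNIV \<and>
        A2 * Re (ip x x) \<le> (\<Sum>\<^sub>\<infinity>i. (cmod (ip x (neg_component Kp Km (f i))))\<^sup>2) \<and>
        (\<Sum>\<^sub>\<infinity>i. (cmod (ip x (neg_component Kp Km (f i))))\<^sup>2) \<le> B2 * Re (ip x x))"

text \<open>
  Both \<open>PK\<close> and \<open>(I - P)K\<close> are Krein spaces under the restricted form, with the decompositions
  used for their frames, and their fundamental symmetries are restrictions of \<open>J\<close>.
\<close>

context krein_space
begin

lemma ip_diff_left: "ip (x - y) z = ip x z - ip y z"
  using ip_add_left[of "x - y" y z] by simp

lemma ip_diff_right: "ip z (x - y) = ip z x - ip z y"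
  using ip_cnj[of z "x - y"] ip_cnj[of z x] ip_cnj[of z y] by (simp add: ip_diff_left)

lemma sub_Kp: "subspace Kp" and sub_Km: "subspace Km"
  using hilbert_pos hilbert_neg by (auto simp: hilbert_subspace_def)

lemma component_unique:
  assumes "p \<in> Kp" "m \<in> Km" "p' \<in> Kp" "m' \<in> Km" "p + m = p' + m'"
  shows "p = p'" "m = m'"
proof -
  have e: "p - p' = m' - m" using assms(5) by (simp add: algebra_simps)
  have "p - p' \<in> Kp" "m' - m \<in> Km"
    using assms sub_Kp sub_Km by (auto intro: subspace_diff)
  then have "p - p' \<in> Kp \<inter> Km" unfolding e by (rule IntI)
  then have "p - p' = 0" "m' - m = 0" unfolding decomp_direct e by blast+
  then show "p = p'" "m = m'" by simp_all
qed

lemma components: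
  assumes "p \<in> Kp" "m \<in> Km"
  shows "pos_component Kp Km (p + m) = p" "neg_component Kp Km (p + m) = m"
    "fundamental_symmetry Kp Km (p + m) = p - m"
proof -
  show 1: "pos_component Kp Km (p + m) = p"
    unfolding pos_component_def
    using assms component_unique[of _ _ p m]
    by (intro the_equality) (force)+
  show 2: "neg_component Kp Km (p + m) = m"
    unfolding neg_component_def
    using assms component_unique(2)[of _ _ p m]
    by (intro the_equality) (force)+
  show "fundamental_symmetry Kp Km (p + m) = p - m"
    unfolding fundamental_symmetry_def 1 2 ..
qed

lemma double_zero:
  fixes x :: 'a
  shows "x + x = 0 \<Longrightarrow> x = 0"
proof -
  assume "x + x = 0"
  then have "smul (1 + 1) x = 0" by (simp only: scale_left_distrib scale_one)
  then show "x = 0" by simp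
qed

lemma commuting_projection_preserves:
  assumes K: "K = UNIV" and lin: "Vector_Spaces.linear smul smul P"
    and comm: "P \<circ> fundamental_symmetry Kp Km = fundamental_symmetry Kp Km \<circ> P"
  shows "P ` Kp \<subseteq> Kp" "P ` Km \<subseteq> Km"
proof -
  interpret P: Vector_Spaces.linear smul smul P by fact
  have dec: "\<exists>p m. p \<in> Kp \<and> m \<in> Km \<and> x = p + m" for x
    using decomp_sum K by blast
  have z: "0 \<in> Kp" "0 \<in> Km" using sub_Kp sub_Km by (auto intro: subspace_0)
  have c: "P (fundamental_symmetry Kp Km x) = fundamental_symmetry Kp Km (P x)" for x
    using comm by (metis comp_apply)
  show "P ` Kp \<subseteq> Kp"
  proof
    fix y assume "y \<in> P ` Kp"
    then obtain x where x: "x \<in> Kp" "y = P x" by auto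
    obtain p m where pm: "p \<in> Kp" "m \<in> Km" "P x = p + m" using dec by blast
    have "fundamental_symmetry Kp Km x = x" using components(3)[OF x(1) z(2)] by simp
    then have "p + m = p - m" using c[of x] components(3)[OF pm(1,2)] unfolding pm(3) by (simp only: pm(3))
    then have "m = - m" unfolding diff_conv_add_uminus by (rule add_left_imp_eq)
    then have "m + m = 0" by (rule iffD1[OF eq_neg_iff_add_eq_0])
    then have "m = 0" by (rule double_zero)
    then show "y \<in> Kp" using pm(1,3) x(2) by (simp only: add_0_right)
  qed
  show "P ` Km \<subseteq> Km"
  proof
    fix y assume "y \<in> P ` Km"
    then obtain x where x: "x \<in> Km" "y = P x" by auto
    obtain p m where pm: "p \<in> Kp" "m \<in> Km" "P x = p + m" using dec by blast
    have "fundamental_symmetry Kp Km x = - x" using components(3)[OF z(1) x(1)] by simp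
    then have "- (p + m) = p - m"
      using c[of x] components(3)[OF pm(1,2)] by (simp only: pm(3) P.neg)
    then have "- p = p" by (simp only: minus_add_distrib diff_conv_add_uminus add_right_cancel)
    then have "p + p = 0" by (intro iffD1[OF eq_neg_iff_add_eq_0]) (rule sym)
    then have "p = 0" by (rule double_zero)
    then show "y \<in> Km" using pm(2,3) x(2) by (simp only: add_0_left)
  qed
qed

end

lemma hilbert_subspace_projection:
  assumes hf: "hermitian_form smul ip" and H: "hilbert_subspace smul ip S"
    and lin: "Vector_Spaces.linear smul smul P"
    and idem: "\<And>x. P (P x) = P x"
    and sa: "\<And>x y. ip (P x) y = ip x (P y)"
    and inv: "P ` S \<subseteq> S"
  shows "hilbert_subspace smul ip (P ` S)"
proof -
  interpret hermitian_form smul ip by fact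
  interpret P: Vector_Spaces.linear smul smul P by fact
  have dl: "ip (x - y) z = ip x z - ip y z" for x y z
    using ip_add_left[of "x - y" y z] by simp
  have dr: "ip z (x - y) = ip z x - ip z y" for x y z
    using ip_cnj[of z "x - y"] ip_cnj[of z x] ip_cnj[of z y] by (simp add: dl)
  have S: "subspace S" and pos: "\<And>x. x \<in> S \<Longrightarrow> x \<noteq> 0 \<Longrightarrow> 0 < Re (ip x x)"
    using H by (auto simp: hilbert_subspace_def)
  have nn: "0 \<le> Re (ip x x)" if "x \<in> S" for x
  proof (cases "x = 0")
    case True
    then have "ip x x = 0" using dl[of x x x] by simp
    then show ?thesis by simp
  qed (use pos[OF that] in auto)
  \<comment> \<open>A projection that is symmetric for a positive form is a contraction, by Pythagoras.\<close>
  have contr: "ip_norm ip (P x) \<le> ip_norm ip x" if "x \<in> S" for x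
  proof -
    have "ip (x - P x) (x - P x) = ip x x - ip (P x) (P x)"
      by (simp add: dl dr sa idem)
    moreover have "x - P x \<in> S" using that inv S by (auto intro: subspace_diff)
    ultimately have "Re (ip (P x) (P x)) \<le> Re (ip x x)" using nn by fastforce
    then show ?thesis by (simp add: ip_norm_def)
  qed
  have "\<exists>l\<in>P ` S. (\<lambda>n. ip_norm ip (X n - l)) \<longlonglongrightarrow> 0"
    if X: "\<forall>n. X n \<in> P ` S" and C: "\<forall>e>0. \<exists>N. \<forall>m\<ge>N. \<forall>n\<ge>N. ip_norm ip (X m - X n) < e"
    for X :: "nat \<Rightarrow> 'a"
  proof -
    have XS: "\<forall>n. X n \<in> S" using X inv by auto
    then obtain l where l: "l \<in> S" "(\<lambda>n. ip_norm ip (X n - l)) \<longlonglongrightarrow> 0"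
      using H C unfolding hilbert_subspace_def by blast
    have PX: "P (X n) = X n" for n using X[rule_format, of n] idem by auto
    have "ip_norm ip (X n - P l) \<le> ip_norm ip (X n - l)" for n
      using contr[of "X n - l"] XS l(1) S by (simp add: P.diff PX subspace_diff)
    moreover have "0 \<le> ip_norm ip (X n - P l)" for n
      using XS l(1) inv S by (auto simp: ip_norm_def intro!: nn subspace_diff)
    ultimately have "(\<lambda>n. ip_norm ip (X n - P l)) \<longlonglongrightarrow> 0"
      by (intro tendsto_sandwich[OF _ _ tendsto_const l(2)]) auto
    then show ?thesis using l(1) by blast
  qed
  moreover have "subspace (P ` S)" using S by (rule P.subspace_image)
  moreover have "0 < Re (ip x x)" if "x \<in> P ` S" "x \<noteq> 0" for x
    using pos that inv by blast
  ultimately show ?thesis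
    unfolding hilbert_subspace_def by (intro conjI ballI allI impI) simp_all
qed

lemma krein_space_range:
  assumes "krein_space smul ip UNIV Kp Km"
    and lin: "Vector_Spaces.linear smul smul P"
    and idem: "\<And>x. P (P x) = P x"
    and sa: "\<And>x y. ip (P x) y = ip x (P y)"
    and comm: "P \<circ> fundamental_symmetry Kp Km = fundamental_symmetry Kp Km \<circ> P"
  shows "krein_space smul ip (range P) (P ` Kp) (P ` Km)"
    and "x \<in> range P \<Longrightarrow> pos_component (P ` Kp) (P ` Km) x = pos_component Kp Km x"
    and "x \<in> range P \<Longrightarrow> neg_component (P ` Kp) (P ` Km) x = neg_component Kp Km x"
    and "x \<in> range P \<Longrightarrow>
      fundamental_symmetry (P ` Kp) (P ` Km) x = fundamental_symmetry Kp Km x"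
proof -
  interpret krein_space smul ip UNIV Kp Km by fact
  interpret P: Vector_Spaces.linear smul smul P by fact
  note inv = commuting_projection_preserves[OF refl lin comm]
  have neg: "hermitian_form smul (\<lambda>x y. - ip x y)"
  proof unfold_locales
    show "- ip y x = cnj (- ip x y)" for x y unfolding complex_cnj_minus ip_cnj[of y x] ..
  qed (simp_all add: ip_add_left ip_scale_left)
  have rng: "range P = {p + m | p m. p \<in> P ` Kp \<and> m \<in> P ` Km}"
  proof -
    have "P x \<in> {p + m | p m. p \<in> P ` Kp \<and> m \<in> P ` Km}" for x
    proof -
      obtain p m where "p \<in> Kp" "m \<in> Km" "x = p + m" using decomp_sum by blast
      then show ?thesis using P.add by blast
    qed
    then show ?thesis by (auto simp: P.add[symmetric])
  qed
  show ks: "krein_space smul ip (range P) (P ` Kp) (P ` Km)"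
  proof unfold_locales
    have "0 \<in> P ` Kp" "0 \<in> P ` Km"
      using subspace_0[OF sub_Kp] subspace_0[OF sub_Km] P.zero by force+
    then show "P ` Kp \<inter> P ` Km = {0}" using inv decomp_direct by blast
    show "ip p m = 0" if "p \<in> P ` Kp" "m \<in> P ` Km" for p m
      using that inv decomp_orthogonal by blast
    show "hilbert_subspace smul ip (P ` Kp)"
      by (intro hilbert_subspace_projection[OF hermitian_form_axioms hilbert_pos lin _ _ inv(1)] idem sa)
    show "hilbert_subspace smul (\<lambda>x y. - ip x y) (P ` Km)"
      by (intro hilbert_subspace_projection[OF neg hilbert_neg lin _ _ inv(2)]) (simp_all add: idem sa)
  qed (fact rng)
  interpret PK: krein_space smul ip "range P" "P ` Kp" "P ` Km" by (fact ks)
  assume "x \<in> range P"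
  then obtain p m where pm: "p \<in> P ` Kp" "m \<in> P ` Km" "x = p + m" using rng by blast
  have pm': "p \<in> Kp" "m \<in> Km" using pm inv by auto
  show "pos_component (P ` Kp) (P ` Km) x = pos_component Kp Km x"
    "neg_component (P ` Kp) (P ` Km) x = neg_component Kp Km x"
    "fundamental_symmetry (P ` Kp) (P ` Km) x = fundamental_symmetry Kp Km x"
    using PK.components[OF pm(1,2)] components[OF pm'] pm(3) by simp_all
qed

theorem krein_space_orthogonal_projection:
  assumes ks: "krein_space smul ip UNIV Kp Km"
    and P: "orthogonal_projection smul ip Kp Km P"
    and comm: "P \<circ> fundamental_symmetry Kp Km = fundamental_symmetry Kp Km \<circ> P"
  shows "krein_space smul ip (range P) (P ` Kp) (P ` Km)"
    and "krein_space smul ip (range (\<lambda>x. x - P x)) ((\<lambda>x. x - P x) ` Kp) ((\<lambda>x. x - P x) ` Km)"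
proof -
  interpret krein_space smul ip UNIV Kp Km by fact
  have lin: "Vector_Spaces.linear smul smul P" and idem: "\<And>x. P (P x) = P x"
    and sa: "\<And>x y. ip (P x) y = ip x (P y)"
    using P unfolding orthogonal_projection_def by simp_all
  interpret P: Vector_Spaces.linear smul smul P by fact
  let ?J = "fundamental_symmetry Kp Km"
  show "krein_space smul ip (range P) (P ` Kp) (P ` Km)"
    by (intro krein_space_range(1)[OF ks lin _ _ comm] idem sa)
  have Jdiff: "?J (x - y) = ?J x - ?J y" for x y
  proof -
    obtain p m p' m' where d: "p \<in> Kp" "m \<in> Km" "x = p + m" "p' \<in> Kp" "m' \<in> Km" "y = p' + m'"
      using decomp_sum by blast
    have "x - y = (p - p') + (m - m')" using d by simp
    moreover have "p - p' \<in> Kp" "m - m' \<in> Km"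
      using d sub_Kp sub_Km by (auto intro: subspace_diff)
    ultimately have "?J (x - y) = (p - p') - (m - m')" using components(3) by metis
    then show ?thesis using d components(3) by simp
  qed
  show "krein_space smul ip (range (\<lambda>x. x - P x)) ((\<lambda>x. x - P x) ` Kp) ((\<lambda>x. x - P x) ` Km)"
  proof (rule krein_space_range(1)[OF ks])
    show "Vector_Spaces.linear smul smul (\<lambda>x. x - P x)"
      by unfold_locales (simp_all add: P.add P.scale scale_right_diff_distrib)
    show "(\<lambda>x. x - P x) \<circ> ?J = ?J \<circ> (\<lambda>x. x - P x)"
      using comm by (auto simp: fun_eq_iff Jdiff)
    show "x - P x - P (x - P x) = x - P x" for x
      by (simp add: P.diff idem)
    show "ip (x - P x) y = ip x (y - P y)" for x y
      by (simp add: ip_diff_left ip_diff_right sa)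
  qed
qed

end

theory Submission
  imports Defs
begin

text \<open>
  Since \<open>K\<^sup>+ \<bottom> K\<^sup>-\<close>, the components of the frame vectors may be replaced by the
  vectors themselves, so a Krein frame is a pair of two-sided bounds, one on each summand. A
  symmetric idempotent \<open>P\<close> satisfies \<open>\<langle>x, P f\<rangle> = \<langle>P x, f\<rangle>\<close>, so restricting to \<open>P x = x\<close> gives (1);
  for (2), the sum over the disjoint union splits into the sums for \<open>P x\<close> and \<open>x - P x\<close>, and
  \<open>\<langle>x, x\<rangle>\<close> splits in the same way by Pythagoras.
\<close>

definition frame_on ::
  "('a \<Rightarrow> 'a \<Rightarrow> complex) \<Rightarrow> 'a set \<Rightarrow> ('i \<Rightarrow> 'a) \<Rightarrow> real \<Rightarrow> real \<Rightarrow> bool" where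
  "frame_on ip S f A B \<longleftrightarrow>
     (\<forall>x\<in>S. \<exists>s. ((\<lambda>i. (cmod (ip x (f i)))\<^sup>2) has_sum s) UNIV \<and>
        A * Re (ip x x) \<le> s \<and> s \<le> B * Re (ip x x))"

lemma frame_on_infsum:
  "frame_on ip S f A B \<longleftrightarrow>
     (\<forall>x\<in>S. (\<lambda>i. (cmod (ip x (f i)))\<^sup>2) summable_on UNIV \<and>
        A * Re (ip x x) \<le> (\<Sum>\<^sub>\<infinity>i. (cmod (ip x (f i)))\<^sup>2) \<and>
        (\<Sum>\<^sub>\<infinity>i. (cmod (ip x (f i)))\<^sup>2) \<le> B * Re (ip x x))"
  by (simp add: frame_on_def has_sum_iff)

lemma (in krein_space) ip_add_right: "ip z (x + y) = ip z x + ip z y"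
  using ip_diff_right[of z "x + y" y] by simp

lemma (in krein_space) ip_components:
  assumes "y \<in> K"
  shows "x \<in> Kp \<Longrightarrow> ip x (pos_component Kp Km y) = ip x y"
    and "x \<in> Km \<Longrightarrow> ip x (neg_component Kp Km y) = ip x y"
proof -
  obtain p m where pm: "p \<in> Kp" "m \<in> Km" "y = p + m"
    using assms decomp_sum by blast
  show "ip x (pos_component Kp Km y) = ip x y" if "x \<in> Kp"
    unfolding pm(3) components[OF pm(1,2)]
    by (simp add: ip_add_right decomp_orthogonal[OF that pm(2)])
  show "ip x (neg_component Kp Km y) = ip x y" if "x \<in> Km"
    unfolding pm(3) components[OF pm(1,2)]
    using ip_cnj[of x p] by (simp add: ip_add_right decomp_orthogonal[OF pm(1) that])
qed

lemma (in krein_space) krein_frame_iff_frame_on: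
  "krein_frame ip K Kp Km f A1 B1 A2 B2 \<longleftrightarrow>
     B2 \<le> A2 \<and> A2 < 0 \<and> 0 < A1 \<and> A1 \<le> B1 \<and> (\<forall>i. f i \<in> K) \<and>
     frame_on ip Kp f A1 B1 \<and> frame_on ip Km f A2 B2"
  unfolding krein_frame_def frame_on_infsum
  by (simp add: ip_components cong: conj_cong)

lemma frame_on_image_projection:
  assumes "frame_on ip S f A B" and "P ` S \<subseteq> S"
    and "\<And>x. P (P x) = P x" and "\<And>x y. ip (P x) y = ip x (P y)"
  shows "frame_on ip (P ` S) (\<lambda>i. P (f i)) A B"
proof -
  have "ip x (P (f i)) = ip x (f i)" if "x \<in> P ` S" for x i
    using that assms(3,4) by (metis imageE)
  then show ?thesis
    using assms(1,2) by (simp add: frame_on_def subset_iff)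
qed

lemma has_sum_case_sum:
  fixes a b :: "_ \<Rightarrow> 'c::topological_comm_monoid_add"
  assumes "(a has_sum s) UNIV" and "(b has_sum t) UNIV"
  shows "(case_sum a b has_sum s + t) UNIV"
  unfolding UNIV_sum
  by (rule has_sum_Un_disjoint) (use assms in \<open>auto simp: has_sum_reindex o_def\<close>)

lemma (in krein_space) frame_on_case_sum:
  assumes f: "frame_on ip (P ` S) f A B" "\<And>i. f i \<in> range P"
    and g: "frame_on ip ((\<lambda>x. x - P x) ` S) g A B" "\<And>i. g i \<in> range (\<lambda>x. x - P x)"
    and idem: "\<And>x. P (P x) = P x" "\<And>x. P (x - P x) = 0"
    and sa: "\<And>x y. ip (P x) y = ip x (P y)"
  shows "frame_on ip S (case_sum f g) A B"
  unfolding frame_on_def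
proof
  fix x assume x: "x \<in> S"
  let ?y = "P x" and ?z = "x - P x"
  have zero: "ip u 0 = 0" for u
    using ip_diff_right[of u 0 0] by simp
  have fP: "P (f i) = f i" for i
    using f(2)[of i] idem by auto
  have gP: "P (g i) = 0" for i
    using g(2)[of i] idem by auto
  have ipf: "ip ?y (f i) = ip x (f i)" for i
    by (simp add: sa fP)
  have ipg: "ip ?z (g i) = ip x (g i)" for i
    by (simp add: ip_diff_left sa gP zero)
  have pyth: "Re (ip x x) = Re (ip ?y ?y) + Re (ip ?z ?z)"
    by (simp add: ip_diff_left ip_diff_right sa idem)
  obtain s where s: "((\<lambda>i. (cmod (ip x (f i)))\<^sup>2) has_sum s) UNIV"
    "A * Re (ip ?y ?y) \<le> s" "s \<le> B * Re (ip ?y ?y)"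
    using f(1) x unfolding frame_on_def by (force simp: ipf)
  obtain t where t: "((\<lambda>i. (cmod (ip x (g i)))\<^sup>2) has_sum t) UNIV"
    "A * Re (ip ?z ?z) \<le> t" "t \<le> B * Re (ip ?z ?z)"
    using g(1) x unfolding frame_on_def by (force simp: ipg)
  have "(\<lambda>i. (cmod (ip x (case_sum f g i)))\<^sup>2) =
      case_sum (\<lambda>i. (cmod (ip x (f i)))\<^sup>2) (\<lambda>i. (cmod (ip x (g i)))\<^sup>2)"
    by (auto simp: fun_eq_iff split: sum.split)
  then have "((\<lambda>i. (cmod (ip x (case_sum f g i)))\<^sup>2) has_sum s + t) UNIV"
    using has_sum_case_sum[OF s(1) t(1)] by simp
  moreover have "A * Re (ip x x) \<le> s + t" "s + t \<le> B * Re (ip x x)"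
    using s(2,3) t(2,3) unfolding pyth distrib_left by linarith+
  ultimately show "\<exists>s. ((\<lambda>i. (cmod (ip x (case_sum f g i)))\<^sup>2) has_sum s) UNIV \<and>
      A * Re (ip x x) \<le> s \<and> s \<le> B * Re (ip x x)"
    by blast
qed

theorem theorem3p2:
  fixes smul :: "complex \<Rightarrow> 'a::ab_group_add \<Rightarrow> 'a"
    and ip :: "'a \<Rightarrow> 'a \<Rightarrow> complex"
    and Kp Km :: "'a set"
    and J P :: "'a \<Rightarrow> 'a"
  assumes "krein_space smul ip UNIV Kp Km"
    and "J = fundamental_symmetry Kp Km"
    and "orthogonal_projection smul ip Kp Km P"
    and "P \<circ> J = J \<circ> P"
  shows "(\<forall>(f::nat \<Rightarrow> 'a) A1 B1 A2 B2.
            krein_frame ip UNIV Kp Km f A1 B1 A2 B2 \<longrightarrow>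
              krein_frame ip (range P) (P ` Kp) (P ` Km) (\<lambda>n. P (f n)) A1 B1 A2 B2 \<and>
              krein_frame ip (range (\<lambda>x. x - P x)) ((\<lambda>x. x - P x) ` Kp) ((\<lambda>x. x - P x) ` Km)
                (\<lambda>n. f n - P (f n)) A1 B1 A2 B2) \<and>
         (\<forall>(f::nat \<Rightarrow> 'a) (g::nat \<Rightarrow> 'a) A1 B1 A2 B2.
            krein_frame ip (range P) (P ` Kp) (P ` Km) f A1 B1 A2 B2 \<and>
            krein_frame ip (range (\<lambda>x. x - P x)) ((\<lambda>x. x - P x) ` Kp) ((\<lambda>x. x - P x) ` Km)
              g A1 B1 A2 B2 \<longrightarrow>
              krein_frame ip UNIV Kp Km (case_sum f g :: nat + nat \<Rightarrow> 'a) A1 B1 A2 B2)"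
proof -
  let ?Q = "\<lambda>x. x - P x"
  interpret krein_space smul ip UNIV Kp Km by fact
  have comm: "P \<circ> fundamental_symmetry Kp Km = fundamental_symmetry Kp Km \<circ> P"
    using assms(2,4) by simp
  note ranges = krein_space_orthogonal_projection[OF assms(1,3) comm]
  interpret PK: krein_space smul ip "range P" "P ` Kp" "P ` Km" by (fact ranges(1))
  interpret QK: krein_space smul ip "range ?Q" "?Q ` Kp" "?Q ` Km" by (fact ranges(2))
  have lin: "Vector_Spaces.linear smul smul P" and idem: "\<And>x. P (P x) = P x"
    and sa: "\<And>x y. ip (P x) y = ip x (P y)"
    using assms(3) unfolding orthogonal_projection_def by simp_all
  interpret P: Vector_Spaces.linear smul smul P by (fact lin)
  note invP = commuting_projection_preserves[OF refl lin comm]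
  have invQ: "?Q ` Kp \<subseteq> Kp" "?Q ` Km \<subseteq> Km"
    using invP sub_Kp sub_Km by (auto intro: subspace_diff)
  have PQ: "P (?Q x) = 0" for x
    by (simp add: P.diff idem)
  then have idemQ: "?Q (?Q x) = ?Q x" for x
    by simp
  have saQ: "ip (?Q x) y = ip x (?Q y)" for x y
    by (simp add: ip_diff_left ip_diff_right sa)
  note iff = krein_frame_iff_frame_on PK.krein_frame_iff_frame_on QK.krein_frame_iff_frame_on
  show ?thesis
  proof (intro conjI allI impI)
    fix f :: "nat \<Rightarrow> 'a" and A1 B1 A2 B2
    assume F: "krein_frame ip UNIV Kp Km f A1 B1 A2 B2"
    show "krein_frame ip (range P) (P ` Kp) (P ` Km) (\<lambda>n. P (f n)) A1 B1 A2 B2"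
      using F unfolding iff by (auto intro!: frame_on_image_projection invP idem sa)
    show "krein_frame ip (range ?Q) (?Q ` Kp) (?Q ` Km) (\<lambda>n. f n - P (f n)) A1 B1 A2 B2"
      using F frame_on_image_projection[of ip _ f _ _ ?Q, OF _ _ idemQ saQ] invQ
      unfolding iff by auto
  next
    fix f g :: "nat \<Rightarrow> 'a" and A1 B1 A2 B2
    assume "krein_frame ip (range P) (P ` Kp) (P ` Km) f A1 B1 A2 B2 \<and>
      krein_frame ip (range ?Q) (?Q ` Kp) (?Q ` Km) g A1 B1 A2 B2"
    then show "krein_frame ip UNIV Kp Km (case_sum f g) A1 B1 A2 B2"
      unfolding iff by (auto intro!: frame_on_case_sum[of P] idem PQ sa)
  qed
qed

end
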